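(* The space $JH$ has the strong diameter two property (and so the norm of $JH^*$ is octahedral).
   Context: All Banach spaces are real. For a Banach space $X$, $B_X$ and $S_X$ are its closed unit ball and unit sphere and $X^*$ its topological dual; for bounded $A\subseteq X$, $x^*\in X^*$ and $\alpha>0$, the slice is $S(A,x^*,\alpha)=\{x\in A:x^*(x)>\sup_{y\in A}x^*(y)-\alpha\}$. $X$ has the strong diameter two property if every convex combination of slices of $B_X$, i.e. every set $\sum_{i=1}^n\lambda_iS_i$ with $S_i$ slices of $B_X$, $\lambda_i\ge0$, $\sum_i\lambda_i=1$, has diameter $2$. The norm of $X$ is octahedral if for every $\varepsilon>0$ and every finite-dimensional subspace $Y$ of $X$ there is $x\in S_X$ such that $\|\lambda x+y\|\ge(1-\varepsilon)(|\lambda|+\|y\|)$ for every $y\in Y$ and every scalar $\lambda$. The dyadic tree is $T=\{(n,i):0\le n<\infty,\ 0\le i<2^n\}$; the offspring of $(n,i)$ are $(n+1,2i)$ and $(n+1,2i+1)$. The $n$-th level of $T$ is $\{(n,i):0\le i<2^n\}$. A segment is a non-empty finite set $\{t_1,\ldots,t_k\}$ such that $t_{j+1}$ is an offspring of $t_j$ for $1\le j\le k-1$; it is an $n$-$m$ segment ($n\le m$) if its first element lies in level $n$ and its last in level $m$ (so it has exactly one element in each level between $n$ and $m$). A finite family $\{S_1,\ldots,S_k\}$ of segments is admissible if there are $p\le q$ such that every $S_i$ is a $p$-$q$ segment and $S_i\cap S_j=\emptyset$ for $i\ne j$. $JH$ is the completion of the space of finitely nonzero functions $x:T\to\mathbb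 R$ under the norm $\|x\|=\max\sum_{i=1}^k\left|\sum_{t\in S_i}x(t)\right|$, the maximum being over all admissible families $\{S_1,\ldots,S_k\}$ of segments of $T$. *)

theory Defs
  imports "HOL-Analysis.Analysis"
begin

section \<open>Slices, the strong diameter two property, octahedral norms\<close>

text \<open>
  The dual of a real Banach space \<open>'a\<close> is the type \<open>'a \<Rightarrow>\<^sub>L real\<close> of bounded linear functionals,
  with the operator norm.
\<close>

definition slice :: "'a::banach set \<Rightarrow> ('a \<Rightarrow>\<^sub>L real) \<Rightarrow> real \<Rightarrow> 'a set" where
  "slice A f \<alpha> = {x \<in> A. blinfun_apply f x > (SUP y\<in>A. blinfun_apply f y) - \<alpha>}"

definition strong_diameter_two :: "'a::banach itself \<Rightarrow> bool" where
  "strong_diameter_two (_ :: 'a itself) \<longleftrightarrow>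
     (\<forall>(n::nat) (f :: nat \<Rightarrow> ('a \<Rightarrow>\<^sub>L real)) (\<alpha> :: nat \<Rightarrow> real) (c :: nat \<Rightarrow> real).
        (\<forall>i<n. \<alpha> i > 0) \<and> (\<forall>i<n. c i \<ge> 0) \<and> (\<Sum>i<n. c i) = 1 \<longrightarrow>
        diameter {(\<Sum>i<n. c i *\<^sub>R x i) | x. \<forall>i<n. x i \<in> slice (cball 0 1) (f i) (\<alpha> i)} = 2)"

definition finite_dim_subspace :: "'a::real_vector set \<Rightarrow> bool" where
  "finite_dim_subspace Y \<longleftrightarrow> (\<exists>B. finite B \<and> Y = span B)"

definition octahedral_norm :: "'a::banach itself \<Rightarrow> bool" where
  "octahedral_norm (_ :: 'a itself) \<longleftrightarrow>
     (\<forall>\<epsilon>>0. \<forall>Y :: 'a set. finite_dim_subspace Y \<longrightarrow>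
        (\<exists>x\<in>sphere 0 1. \<forall>y\<in>Y. \<forall>c::real.
           norm (c *\<^sub>R x + y) \<ge> (1 - \<epsilon>) * (\<bar>c\<bar> + norm y)))"


section \<open>Completion of a normed space\<close>

lemma Cauchy_const_seq: "Cauchy (\<lambda>_. c :: 'a::real_normed_vector)"
  by (simp add: convergent_Cauchy convergent_const)

text \<open>Cauchy sequences modulo null sequences.\<close>

quotient_type (overloaded) 'a cauchy_completion = "nat \<Rightarrow> 'a::real_normed_vector" /
  partial: "\<lambda>X Y. Cauchy X \<and> Cauchy Y \<and> (\<lambda>n. X n - Y n) \<longlonglongrightarrow> 0"
proof (rule part_equivpI)
  show "\<exists>X::nat \<Rightarrow> 'a. Cauchy X \<and> Cauchy X \<and> (\<lambda>n. X n - X n) \<longlonglongrightarrow> 0"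
    by (intro exI[of _ "\<lambda>_. 0"]) (auto intro: Cauchy_const_seq)
  show "symp (\<lambda>X Y::nat \<Rightarrow> 'a. Cauchy X \<and> Cauchy Y \<and> (\<lambda>n. X n - Y n) \<longlonglongrightarrow> 0)"
  proof (rule sympI)
    fix X Y :: "nat \<Rightarrow> 'a"
    assume "Cauchy X \<and> Cauchy Y \<and> (\<lambda>n. X n - Y n) \<longlonglongrightarrow> 0"
    then show "Cauchy Y \<and> Cauchy X \<and> (\<lambda>n. Y n - X n) \<longlonglongrightarrow> 0"
      using tendsto_minus[of "\<lambda>n. X n - Y n" 0 sequentially] by simp
  qed
  show "transp (\<lambda>X Y::nat \<Rightarrow> 'a. Cauchy X \<and> Cauchy Y \<and> (\<lambda>n. X n - Y n) \<longlonglongrightarrow> 0)"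
  proof (rule transpI)
    fix X Y Z :: "nat \<Rightarrow> 'a"
    assume "Cauchy X \<and> Cauchy Y \<and> (\<lambda>n. X n - Y n) \<longlonglongrightarrow> 0"
      "Cauchy Y \<and> Cauchy Z \<and> (\<lambda>n. Y n - Z n) \<longlonglongrightarrow> 0"
    then show "Cauchy X \<and> Cauchy Z \<and> (\<lambda>n. X n - Z n) \<longlonglongrightarrow> 0"
      using tendsto_add[of "\<lambda>n. X n - Y n" 0 sequentially "\<lambda>n. Y n - Z n" 0] by simp
  qed
qed

lemma Cauchy_norm_convergent:
  fixes X :: "nat \<Rightarrow> 'a::real_normed_vector"
  assumes "Cauchy X"
  shows "convergent (\<lambda>n. norm (X n))"
proof -
  have "Cauchy (\<lambda>n. norm (X n))"
  proof (rule metric_CauchyI)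
    fix e :: real assume "e > 0"
    then obtain M where M: "\<forall>m\<ge>M. \<forall>n\<ge>M. dist (X m) (X n) < e"
      using assms unfolding Cauchy_def by blast
    have "dist (norm (X m)) (norm (X n)) \<le> dist (X m) (X n)" for m n
      by (simp add: dist_norm norm_triangle_ineq3)
    with M show "\<exists>M. \<forall>m\<ge>M. \<forall>n\<ge>M. dist (norm (X m)) (norm (X n)) < e"
      by (meson le_less_trans)
  qed
  then show ?thesis by (simp add: Cauchy_convergent_iff)
qed

lemma Cauchy_scaleR_seq:
  fixes X :: "nat \<Rightarrow> 'a::real_normed_vector"
  assumes "Cauchy X"
  shows "Cauchy (\<lambda>n. c *\<^sub>R X n)"
  using bounded_linear.Cauchy[OF bounded_linear_scaleR_right assms] .

lemma Cauchy_add_seq: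
  fixes X Y :: "nat \<Rightarrow> 'a::real_normed_vector"
  assumes "Cauchy X" "Cauchy Y"
  shows "Cauchy (\<lambda>n. X n + Y n)"
proof (rule CauchyI)
  fix e :: real assume "e > 0"
  then have e2: "e / 2 > 0" by simp
  obtain M where M: "\<forall>m\<ge>M. \<forall>n\<ge>M. norm (X m - X n) < e / 2"
    using CauchyD[OF assms(1) e2] by blast
  obtain N where N: "\<forall>m\<ge>N. \<forall>n\<ge>N. norm (Y m - Y n) < e / 2"
    using CauchyD[OF assms(2) e2] by blast
  have "norm ((X m + Y m) - (X n + Y n)) < e" if "m \<ge> max M N" "n \<ge> max M N" for m n
  proof -
    have "norm (X m - X n) < e / 2" "norm (Y m - Y n) < e / 2" using M N that by auto
    then show ?thesis
      using norm_triangle_ineq[of "X m - X n" "Y m - Y n"] by (simp add: add_diff_add)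
  qed
  then show "\<exists>M. \<forall>m\<ge>M. \<forall>n\<ge>M. norm ((X m + Y m) - (X n + Y n)) < e" by blast
qed

lemma Cauchy_uminus_seq:
  fixes X :: "nat \<Rightarrow> 'a::real_normed_vector"
  assumes "Cauchy X"
  shows "Cauchy (\<lambda>n. - X n)"
  using Cauchy_scaleR_seq[OF assms, of "-1"] by simp

lemma Cauchy_diff_seq:
  fixes X Y :: "nat \<Rightarrow> 'a::real_normed_vector"
  assumes "Cauchy X" "Cauchy Y"
  shows "Cauchy (\<lambda>n. X n - Y n)"
  using Cauchy_add_seq[OF assms(1) Cauchy_uminus_seq[OF assms(2)]] by simp

instantiation cauchy_completion :: (real_normed_vector) real_normed_vector
begin

lift_definition zero_cauchy_completion :: "'a cauchy_completion" is "\<lambda>_. 0"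
  by (auto intro: Cauchy_const_seq)

lift_definition plus_cauchy_completion ::
  "'a cauchy_completion \<Rightarrow> 'a cauchy_completion \<Rightarrow> 'a cauchy_completion"
  is "\<lambda>X Y n. X n + Y n"
proof -
  fix X X' Y Y' :: "nat \<Rightarrow> 'a"
  assume *: "Cauchy X \<and> Cauchy X' \<and> (\<lambda>n. X n - X' n) \<longlonglongrightarrow> 0"
    "Cauchy Y \<and> Cauchy Y' \<and> (\<lambda>n. Y n - Y' n) \<longlonglongrightarrow> 0"
  have "(\<lambda>n. (X n - X' n) + (Y n - Y' n)) \<longlonglongrightarrow> 0 + 0"
    using * by (intro tendsto_add) auto
  then show "Cauchy (\<lambda>n. X n + Y n) \<and> Cauchy (\<lambda>n. X' n + Y' n) \<and>
      (\<lambda>n. (X n + Y n) - (X' n + Y' n)) \<longlonglongrightarrow> 0"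
    using * by (auto intro: Cauchy_add_seq simp: algebra_simps)
qed

lift_definition uminus_cauchy_completion :: "'a cauchy_completion \<Rightarrow> 'a cauchy_completion"
  is "\<lambda>X n. - X n"
proof -
  fix X X' :: "nat \<Rightarrow> 'a"
  assume *: "Cauchy X \<and> Cauchy X' \<and> (\<lambda>n. X n - X' n) \<longlonglongrightarrow> 0"
  have "(\<lambda>n. - (X n - X' n)) \<longlonglongrightarrow> - 0"
    using * by (intro tendsto_minus) auto
  then show "Cauchy (\<lambda>n. - X n) \<and> Cauchy (\<lambda>n. - X' n) \<and> (\<lambda>n. - X n - (- X' n)) \<longlonglongrightarrow> 0"
    using * by (auto intro: Cauchy_uminus_seq simp: algebra_simps)
qed

definition minus_cauchy_completion ::
  "'a cauchy_completion \<Rightarrow> 'a cauchy_completion \<Rightarrow> 'a cauchy_completion" where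
  "minus_cauchy_completion x y = x + (- y)"

lift_definition scaleR_cauchy_completion :: "real \<Rightarrow> 'a cauchy_completion \<Rightarrow> 'a cauchy_completion"
  is "\<lambda>c X n. c *\<^sub>R X n"
proof -
  fix c :: real and X X' :: "nat \<Rightarrow> 'a"
  assume *: "Cauchy X \<and> Cauchy X' \<and> (\<lambda>n. X n - X' n) \<longlonglongrightarrow> 0"
  have "(\<lambda>n. c *\<^sub>R (X n - X' n)) \<longlonglongrightarrow> c *\<^sub>R 0"
    using * by (intro tendsto_scaleR tendsto_const) auto
  then show "Cauchy (\<lambda>n. c *\<^sub>R X n) \<and> Cauchy (\<lambda>n. c *\<^sub>R X' n) \<and>
      (\<lambda>n. c *\<^sub>R X n - c *\<^sub>R X' n) \<longlonglongrightarrow> 0"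
    using * by (auto intro: Cauchy_scaleR_seq simp: algebra_simps)
qed

lift_definition norm_cauchy_completion :: "'a cauchy_completion \<Rightarrow> real"
  is "\<lambda>X. lim (\<lambda>n. norm (X n))"
proof -
  fix X X' :: "nat \<Rightarrow> 'a"
  assume *: "Cauchy X \<and> Cauchy X' \<and> (\<lambda>n. X n - X' n) \<longlonglongrightarrow> 0"
  obtain l where l: "(\<lambda>n. norm (X n)) \<longlonglongrightarrow> l"
    using * Cauchy_norm_convergent convergent_def by blast
  have "(\<lambda>n. norm (X n) - norm (X' n)) \<longlonglongrightarrow> 0"
  proof (rule Lim_null_comparison)
    show "\<forall>\<^sub>F n in sequentially. norm (norm (X n) - norm (X' n)) \<le> norm (X n - X' n)"
      by (simp add: norm_triangle_ineq3)
    show "(\<lambda>n. norm (X n - X' n)) \<longlonglongrightarrow> 0"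
      using * by (simp add: tendsto_norm_zero)
  qed
  from tendsto_diff[OF l this] have "(\<lambda>n. norm (X' n)) \<longlonglongrightarrow> l" by simp
  with l show "lim (\<lambda>n. norm (X n)) = lim (\<lambda>n. norm (X' n))"
    by (simp add: limI)
qed

definition dist_cauchy_completion ::
  "'a cauchy_completion \<Rightarrow> 'a cauchy_completion \<Rightarrow> real" where
  "dist_cauchy_completion x y = norm (x - y)"

definition sgn_cauchy_completion :: "'a cauchy_completion \<Rightarrow> 'a cauchy_completion" where
  "sgn_cauchy_completion x = inverse (norm x) *\<^sub>R x"

definition uniformity_cauchy_completion ::
  "('a cauchy_completion \<times> 'a cauchy_completion) filter" where
  "uniformity_cauchy_completion = (INF e\<in>{0<..}. principal {(x, y). dist x y < e})"

definition open_cauchy_completion :: "'a cauchy_completion set \<Rightarrow> bool" where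
  "open_cauchy_completion U =
     (\<forall>x\<in>U. eventually (\<lambda>(x', y). x' = x \<longrightarrow> y \<in> U) uniformity)"

instance
proof
  fix x y z :: "'a cauchy_completion" and a b :: real
  show "x + y + z = x + (y + z)"
    by transfer (auto intro: Cauchy_add_seq simp: add.assoc)
  show "x + y = y + x"
    by transfer (auto intro: Cauchy_add_seq simp: add.commute)
  show "0 + x = x" by transfer simp
  show "- x + x = 0"
    by transfer (auto intro: Cauchy_const_seq)
  show "x - y = x + - y" by (simp add: minus_cauchy_completion_def)
  show "a *\<^sub>R (x + y) = a *\<^sub>R x + a *\<^sub>R y"
    by transfer (auto intro: Cauchy_add_seq Cauchy_scaleR_seq simp: scaleR_add_right)
  show "(a + b) *\<^sub>R x = a *\<^sub>R x + b *\<^sub>R x"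
    by transfer (auto intro: Cauchy_add_seq Cauchy_scaleR_seq simp: scaleR_add_left)
  show "a *\<^sub>R b *\<^sub>R x = (a * b) *\<^sub>R x"
    by transfer (auto intro: Cauchy_scaleR_seq)
  show "1 *\<^sub>R x = x" by transfer simp
  show "dist x y = norm (x - y)" by (simp add: dist_cauchy_completion_def)
  show "sgn x = inverse (norm x) *\<^sub>R x" by (simp add: sgn_cauchy_completion_def)
  show "uniformity = (INF e\<in>{0<..}. principal {(x, y::'a cauchy_completion). dist x y < e})"
    by (simp add: uniformity_cauchy_completion_def)
  show "open U = (\<forall>x\<in>U. eventually (\<lambda>(x', y). x' = x \<longrightarrow> y \<in> U) uniformity)"
    for U :: "'a cauchy_completion set"
    by (simp add: open_cauchy_completion_def)
  show "norm x = 0 \<longleftrightarrow> x = 0"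
  proof (transfer, elim conjE, intro iffI)
    fix X :: "nat \<Rightarrow> 'a"
    assume X: "Cauchy X" and "lim (\<lambda>n. norm (X n)) = 0"
    then have "(\<lambda>n. norm (X n)) \<longlonglongrightarrow> 0"
      using Cauchy_norm_convergent[OF X] by (metis convergent_LIMSEQ_iff)
    then show "Cauchy X \<and> Cauchy (\<lambda>_. 0::'a) \<and> (\<lambda>n. X n - 0) \<longlonglongrightarrow> 0"
      using X Cauchy_const_seq[of "0::'a"] by (simp add: tendsto_norm_zero_iff)
  next
    fix X :: "nat \<Rightarrow> 'a"
    assume "Cauchy X \<and> Cauchy (\<lambda>_. 0::'a) \<and> (\<lambda>n. X n - 0) \<longlonglongrightarrow> 0"
    then show "lim (\<lambda>n. norm (X n)) = 0"
      by (simp add: limI tendsto_norm_zero)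
  qed
  show "norm (x + y) \<le> norm x + norm y"
  proof (transfer, elim conjE)
    fix X Y :: "nat \<Rightarrow> 'a"
    assume X: "Cauchy X" and Y: "Cauchy Y"
    have "(\<lambda>n. norm (X n + Y n)) \<longlonglongrightarrow> lim (\<lambda>n. norm (X n + Y n))"
      "(\<lambda>n. norm (X n) + norm (Y n)) \<longlonglongrightarrow> lim (\<lambda>n. norm (X n)) + lim (\<lambda>n. norm (Y n))"
      using Cauchy_norm_convergent[OF X] Cauchy_norm_convergent[OF Y]
        Cauchy_norm_convergent[OF Cauchy_add_seq[OF X Y]]
      by (auto intro: tendsto_add simp: convergent_LIMSEQ_iff)
    then show "lim (\<lambda>n. norm (X n + Y n)) \<le> lim (\<lambda>n. norm (X n)) + lim (\<lambda>n. norm (Y n))"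
      by (rule LIMSEQ_le) (auto intro: norm_triangle_ineq)
  qed
  show "norm (a *\<^sub>R x) = \<bar>a\<bar> * norm x"
  proof (transfer, elim conjE)
    fix a :: real and X :: "nat \<Rightarrow> 'a"
    assume X: "Cauchy X"
    have "(\<lambda>n. \<bar>a\<bar> * norm (X n)) \<longlonglongrightarrow> \<bar>a\<bar> * lim (\<lambda>n. norm (X n))"
      using Cauchy_norm_convergent[OF X]
      by (intro tendsto_mult tendsto_const) (simp add: convergent_LIMSEQ_iff)
    then show "lim (\<lambda>n. norm (a *\<^sub>R X n)) = \<bar>a\<bar> * lim (\<lambda>n. norm (X n))"
      by (simp add: limI)
  qed
qed

end

lift_definition to_completion :: "'a::real_normed_vector \<Rightarrow> 'a cauchy_completion" is "\<lambda>x _. x"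
  by (auto intro: Cauchy_const_seq)

lemma norm_to_completion: "norm (to_completion x) = norm x"
  by transfer simp

lemma to_completion_add: "to_completion (x + y) = to_completion x + to_completion y"
  by transfer (auto intro: Cauchy_const_seq)

lemma to_completion_scaleR: "to_completion (c *\<^sub>R x) = c *\<^sub>R to_completion x"
  by transfer (auto intro: Cauchy_const_seq)

lemma linear_to_completion: "linear to_completion"
  by (intro linearI to_completion_add to_completion_scaleR)

lemma to_completion_diff: "to_completion (x - y) = to_completion x - to_completion y"
  using linear_diff[OF linear_to_completion] .

lemma norm_to_completion_diff_abs:
  assumes "Cauchy X"
  shows "norm (to_completion a - abs_cauchy_completion X) = lim (\<lambda>n. norm (a - X n))"
proof -
  have c: "Cauchy (\<lambda>_::nat. a)" by (rule Cauchy_const_seq)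
  have n: "Cauchy (\<lambda>n. - X n)" by (rule Cauchy_uminus_seq[OF assms])
  have d: "Cauchy (\<lambda>n. a + - X n)" by (rule Cauchy_add_seq[OF c n])
  have "- abs_cauchy_completion X = abs_cauchy_completion (\<lambda>n. - X n)"
    by (rule uminus_cauchy_completion.abs_eq) (simp add: assms)
  moreover have "abs_cauchy_completion (\<lambda>_. a) + abs_cauchy_completion (\<lambda>n. - X n) =
      abs_cauchy_completion (\<lambda>n. a + - X n)"
    by (rule plus_cauchy_completion.abs_eq) (simp_all add: c n)
  ultimately have "to_completion a - abs_cauchy_completion X =
      abs_cauchy_completion (\<lambda>n. a + - X n)"
    by (simp only: minus_cauchy_completion_def to_completion.abs_eq)
  moreover have "norm (abs_cauchy_completion (\<lambda>n. a + - X n)) = lim (\<lambda>n. norm (a + - X n))"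
    by (rule norm_cauchy_completion.abs_eq) (simp only: d, simp)
  ultimately show ?thesis by simp
qed

lemma to_completion_tendsto:
  assumes X: "Cauchy X"
  shows "(\<lambda>n. to_completion (X n)) \<longlonglongrightarrow> abs_cauchy_completion X"
proof (rule metric_LIMSEQ_I)
  fix e :: real assume "e > 0"
  then have e2: "e / 2 > 0" by simp
  obtain M where M: "\<forall>m\<ge>M. \<forall>n\<ge>M. norm (X m - X n) < e / 2"
    using CauchyD[OF X e2] by blast
  have "dist (to_completion (X m)) (abs_cauchy_completion X) < e" if "m \<ge> M" for m
  proof -
    have "Cauchy (\<lambda>n. X m - X n)"
      by (rule Cauchy_diff_seq[OF Cauchy_const_seq X])
    then have "(\<lambda>n. norm (X m - X n)) \<longlonglongrightarrow> lim (\<lambda>n. norm (X m - X n))"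
      using Cauchy_norm_convergent convergent_LIMSEQ_iff by blast
    then have "lim (\<lambda>n. norm (X m - X n)) \<le> e / 2"
      by (rule LIMSEQ_le_const2) (use M that in \<open>auto intro!: exI[of _ M] less_imp_le\<close>)
    with \<open>e > 0\<close> show ?thesis
      by (simp add: dist_norm norm_to_completion_diff_abs[OF X])
  qed
  then show "\<exists>M. \<forall>m\<ge>M. dist (to_completion (X m)) (abs_cauchy_completion X) < e" by blast
qed

lemma closure_range_to_completion:
  "closure (range to_completion) = (UNIV :: 'a::real_normed_vector cauchy_completion set)"
proof -
  have "x \<in> closure (range to_completion)" for x :: "'a cauchy_completion"
  proof (induction x rule: cauchy_completion.abs_induct)
    case (1 X)
    then have "Cauchy X" by simp
    from to_completion_tendsto[OF this] show ?case
      unfolding closure_sequential by (intro exI[of _ "\<lambda>n. to_completion (X n)"]) simp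
  qed
  then show ?thesis by blast
qed

instance cauchy_completion :: (real_normed_vector) banach
proof
  fix F :: "nat \<Rightarrow> 'a cauchy_completion"
  assume F: "Cauchy F"
  have "\<exists>a. dist (to_completion a) (F n) < 1 / Suc n" for n
    using closure_range_to_completion closure_approachable[of "F n" "range to_completion"]
    by fastforce
  then obtain X where X: "\<And>n. dist (to_completion (X n)) (F n) < 1 / Suc n" by metis
  have null: "(\<lambda>n. to_completion (X n) - F n) \<longlonglongrightarrow> 0"
  proof (rule Lim_null_comparison)
    show "\<forall>\<^sub>F n in sequentially. norm (to_completion (X n) - F n) \<le> 1 / Suc n"
      using X by (simp add: dist_norm less_imp_le)
    show "(\<lambda>n. 1 / real (Suc n)) \<longlonglongrightarrow> 0" using lim_const_over_n[of 1, THEN LIMSEQ_Suc] by simp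
  qed
  have "Cauchy (\<lambda>n. (to_completion (X n) - F n) + F n)"
    using null F by (intro Cauchy_add_seq) (auto intro: LIMSEQ_imp_Cauchy)
  then have "Cauchy X"
    by (simp add: Cauchy_def dist_norm norm_to_completion flip: to_completion_diff)
  from tendsto_diff[OF to_completion_tendsto[OF this] null] show "convergent F"
    by (auto simp: convergent_def)
qed


section \<open>The space JH\<close>

definition dyadic_tree :: "(nat \<times> nat) set" where
  "dyadic_tree = {(n, i). i < 2 ^ n}"

definition offspring :: "nat \<times> nat \<Rightarrow> (nat \<times> nat) set" where
  "offspring t = {(fst t + 1, 2 * snd t), (fst t + 1, 2 * snd t + 1)}"

definition level :: "nat \<Rightarrow> (nat \<times> nat) set" where
  "level n = {(n, i) | i. i < 2 ^ n}"

text \<open>\<open>segment n m S\<close> means that \<open>S\<close> is an \<open>n\<close>-\<open>m\<close> segment.\<close>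

definition segment :: "nat \<Rightarrow> nat \<Rightarrow> (nat \<times> nat) set \<Rightarrow> bool" where
  "segment n m S \<longleftrightarrow>
     (\<exists>ts. ts \<noteq> [] \<and> S = set ts \<and> S \<subseteq> dyadic_tree \<and>
       (\<forall>j. Suc j < length ts \<longrightarrow> ts ! Suc j \<in> offspring (ts ! j)) \<and>
       hd ts \<in> level n \<and> last ts \<in> level m)"

text \<open>
  Segments are non-empty, so a pairwise disjoint finite family of segments has no repetitions
  and is the same thing as a finite disjoint set of segments.
\<close>

definition admissible :: "(nat \<times> nat) set set \<Rightarrow> bool" where
  "admissible \<S> \<longleftrightarrow>
     finite \<S> \<and> disjoint \<S> \<and> (\<exists>p q. p \<le> q \<and> (\<forall>S\<in>\<S>. segment p q S))"

typedef jh_fin = "{x :: nat \<times> nat \<Rightarrow> real. finite {t. x t \<noteq> 0} \<and> {t. x t \<noteq> 0} \<subseteq> dyadic_tree}"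
  morphisms jh_coord Abs_jh_fin
  by (rule exI[of _ "\<lambda>_. 0"]) simp

setup_lifting type_definition_jh_fin

lemma segment_finite: "segment p q S \<Longrightarrow> finite S"
  by (auto simp: segment_def)

lemma segment_singleton: "t \<in> dyadic_tree \<Longrightarrow> segment (fst t) (fst t) {t}"
  unfolding segment_def by (rule exI[of _ "[t]"]) (auto simp: dyadic_tree_def level_def)

lemma finite_admissible_sums:
  fixes x :: "nat \<times> nat \<Rightarrow> real"
  assumes "finite {t. x t \<noteq> 0}"
  shows "finite {(\<Sum>S\<in>\<S>. \<bar>\<Sum>t\<in>S. x t\<bar>) | \<S>. admissible \<S>}"
proof -
  let ?D = "{t. x t \<noteq> 0}"
  let ?v = "\<lambda>A. \<bar>\<Sum>t\<in>A. x t\<bar>"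
  have "\<exists>G\<in>Pow (Pow ?D). (\<Sum>S\<in>\<S>. ?v S) = (\<Sum>A\<in>G. ?v A)" if "admissible \<S>" for \<S>
  proof -
    have fin: "finite \<S>" and dis: "disjoint \<S>" and finS: "\<And>S. S \<in> \<S> \<Longrightarrow> finite S"
      using that segment_finite unfolding admissible_def by blast+
    let ?S' = "{S \<in> \<S>. S \<inter> ?D \<noteq> {}}"
    have eq: "?v S = ?v (S \<inter> ?D)" if "S \<in> \<S>" for S
    proof -
      have "(\<Sum>t\<in>S. x t) = (\<Sum>t\<in>S \<inter> ?D. x t)"
        using finS[OF that] by (intro sum.mono_neutral_right) auto
      then show ?thesis by simp
    qed
    have inj: "inj_on (\<lambda>S. S \<inter> ?D) ?S'"
      using dis unfolding inj_on_def disjoint_def by blast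
    have "(\<Sum>S\<in>\<S>. ?v S) = (\<Sum>S\<in>\<S>. ?v (S \<inter> ?D))"
      using eq by (intro sum.cong) auto
    also have "\<dots> = (\<Sum>S\<in>?S'. ?v (S \<inter> ?D))"
      using fin by (intro sum.mono_neutral_right) auto
    also have "\<dots> = (\<Sum>A\<in>(\<lambda>S. S \<inter> ?D) ` ?S'. ?v A)"
      using inj by (simp add: sum.reindex)
    finally show ?thesis by (intro bexI[of _ "(\<lambda>S. S \<inter> ?D) ` ?S'"]) auto
  qed
  then have "{(\<Sum>S\<in>\<S>. ?v S) | \<S>. admissible \<S>} \<subseteq> (\<lambda>G. \<Sum>A\<in>G. ?v A) ` Pow (Pow ?D)"
    by blast
  then show ?thesis
    by (rule finite_subset) (use assms in simp)
qed

instantiation jh_fin :: real_normed_vector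
begin

lift_definition zero_jh_fin :: jh_fin is "\<lambda>_. 0" by simp

lift_definition plus_jh_fin :: "jh_fin \<Rightarrow> jh_fin \<Rightarrow> jh_fin" is "\<lambda>x y t. x t + y t"
proof -
  fix x y :: "nat \<times> nat \<Rightarrow> real"
  assume *: "finite {t. x t \<noteq> 0} \<and> {t. x t \<noteq> 0} \<subseteq> dyadic_tree"
    "finite {t. y t \<noteq> 0} \<and> {t. y t \<noteq> 0} \<subseteq> dyadic_tree"
  have "{t. x t + y t \<noteq> 0} \<subseteq> {t. x t \<noteq> 0} \<union> {t. y t \<noteq> 0}" by auto
  with * show "finite {t. x t + y t \<noteq> 0} \<and> {t. x t + y t \<noteq> 0} \<subseteq> dyadic_tree"
    by (meson finite_UnI finite_subset le_sup_iff order_trans)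
qed

lift_definition uminus_jh_fin :: "jh_fin \<Rightarrow> jh_fin" is "\<lambda>x t. - x t" by simp

definition minus_jh_fin :: "jh_fin \<Rightarrow> jh_fin \<Rightarrow> jh_fin" where
  "minus_jh_fin x y = x + (- y)"

lift_definition scaleR_jh_fin :: "real \<Rightarrow> jh_fin \<Rightarrow> jh_fin" is "\<lambda>c x t. c * x t"
  by (auto elim: rev_finite_subset)

definition norm_jh_fin :: "jh_fin \<Rightarrow> real" where
  "norm_jh_fin x = Max {(\<Sum>S\<in>\<S>. \<bar>\<Sum>t\<in>S. jh_coord x t\<bar>) | \<S>. admissible \<S>}"

definition dist_jh_fin :: "jh_fin \<Rightarrow> jh_fin \<Rightarrow> real" where
  "dist_jh_fin x y = norm (x - y)"

definition sgn_jh_fin :: "jh_fin \<Rightarrow> jh_fin" where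
  "sgn_jh_fin x = inverse (norm x) *\<^sub>R x"

definition uniformity_jh_fin :: "(jh_fin \<times> jh_fin) filter" where
  "uniformity_jh_fin = (INF e\<in>{0<..}. principal {(x, y). dist x y < e})"

definition open_jh_fin :: "jh_fin set \<Rightarrow> bool" where
  "open_jh_fin U = (\<forall>x\<in>U. eventually (\<lambda>(x', y). x' = x \<longrightarrow> y \<in> U) uniformity)"

lemma jh_finite_vals: "finite {(\<Sum>S\<in>\<S>. \<bar>\<Sum>t\<in>S. jh_coord x t\<bar>) | \<S>. admissible \<S>}"
  using jh_coord[of x] by (intro finite_admissible_sums) simp

lemma admissible_empty: "admissible {}"
  by (auto simp: admissible_def)

lemma jh_norm_ge: "admissible \<S> \<Longrightarrow> (\<Sum>S\<in>\<S>. \<bar>\<Sum>t\<in>S. jh_coord x t\<bar>) \<le> norm x"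
  unfolding norm_jh_fin_def by (rule Max_ge[OF jh_finite_vals]) blast

lemma jh_norm_attained:
  obtains \<S> where "admissible \<S>" "norm x = (\<Sum>S\<in>\<S>. \<bar>\<Sum>t\<in>S. jh_coord x t\<bar>)"
  using Max_in[OF jh_finite_vals[of x]] admissible_empty
  unfolding norm_jh_fin_def[symmetric] by blast

instance
proof
  fix x y z :: jh_fin and a b :: real
  show "x + y + z = x + (y + z)" by transfer (auto simp: add.assoc)
  show "x + y = y + x" by transfer (auto simp: add.commute)
  show "0 + x = x" by transfer simp
  show "- x + x = 0" by transfer simp
  show "x - y = x + - y" by (simp add: minus_jh_fin_def)
  show "a *\<^sub>R (x + y) = a *\<^sub>R x + a *\<^sub>R y" by transfer (auto simp: algebra_simps)
  show "(a + b) *\<^sub>R x = a *\<^sub>R x + b *\<^sub>R x" by transfer (auto simp: algebra_simps)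
  show "a *\<^sub>R b *\<^sub>R x = (a * b) *\<^sub>R x" by transfer (auto simp: algebra_simps)
  show "1 *\<^sub>R x = x" by transfer simp
  show "dist x y = norm (x - y)" by (simp add: dist_jh_fin_def)
  show "sgn x = inverse (norm x) *\<^sub>R x" by (simp add: sgn_jh_fin_def)
  show "uniformity = (INF e\<in>{0<..}. principal {(x, y::jh_fin). dist x y < e})"
    by (simp add: uniformity_jh_fin_def)
  show "open U = (\<forall>x\<in>U. eventually (\<lambda>(x', y). x' = x \<longrightarrow> y \<in> U) uniformity)"
    for U :: "jh_fin set"
    by (simp add: open_jh_fin_def)
  show "norm x = 0 \<longleftrightarrow> x = 0"
  proof
    assume n: "norm x = 0"
    have "jh_coord x t = 0" for t
    proof (cases "t \<in> dyadic_tree")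
      case True
      then have "admissible {{t}}"
        using segment_singleton[OF True] by (auto simp: admissible_def)
      from jh_norm_ge[OF this, of x] n show ?thesis by simp
    next
      case False
      then show ?thesis using jh_coord[of x] by blast
    qed
    then have "jh_coord x = jh_coord 0" by (simp add: zero_jh_fin.rep_eq fun_eq_iff)
    then show "x = 0" by (simp add: jh_coord_inject)
  next
    assume "x = 0"
    then show "norm x = 0"
      by (metis (no_types, lifting) abs_zero jh_norm_attained sum.neutral zero_jh_fin.rep_eq)
  qed
  show "norm (x + y) \<le> norm x + norm y"
  proof -
    obtain \<S> where S: "admissible \<S>" "norm (x + y) = (\<Sum>S\<in>\<S>. \<bar>\<Sum>t\<in>S. jh_coord (x + y) t\<bar>)"
      by (rule jh_norm_attained)
    have "norm (x + y) \<le> (\<Sum>S\<in>\<S>. \<bar>\<Sum>t\<in>S. jh_coord x t\<bar> + \<bar>\<Sum>t\<in>S. jh_coord y t\<bar>)"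
      unfolding S(2) by (intro sum_mono) (simp add: plus_jh_fin.rep_eq sum.distrib abs_triangle_ineq)
    also have "\<dots> \<le> norm x + norm y"
      using jh_norm_ge[OF S(1), of x] jh_norm_ge[OF S(1), of y] by (simp add: sum.distrib)
    finally show ?thesis .
  qed
  have scale: "(\<Sum>S\<in>\<S>. \<bar>\<Sum>t\<in>S. jh_coord (a *\<^sub>R x) t\<bar>) =
      \<bar>a\<bar> * (\<Sum>S\<in>\<S>. \<bar>\<Sum>t\<in>S. jh_coord x t\<bar>)" for \<S>
    by (simp add: scaleR_jh_fin.rep_eq sum_distrib_left[symmetric] abs_mult)
  show "norm (a *\<^sub>R x) = \<bar>a\<bar> * norm x"
  proof (rule antisym)
    obtain \<S> where S: "admissible \<S>" "norm (a *\<^sub>R x) = (\<Sum>S\<in>\<S>. \<bar>\<Sum>t\<in>S. jh_coord (a *\<^sub>R x) t\<bar>)"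
      by (rule jh_norm_attained)
    show "norm (a *\<^sub>R x) \<le> \<bar>a\<bar> * norm x"
      unfolding S(2) scale by (intro mult_left_mono jh_norm_ge S(1)) simp
    obtain \<S>' where S': "admissible \<S>'" "norm x = (\<Sum>S\<in>\<S>'. \<bar>\<Sum>t\<in>S. jh_coord x t\<bar>)"
      by (rule jh_norm_attained)
    show "\<bar>a\<bar> * norm x \<le> norm (a *\<^sub>R x)"
      unfolding S'(2) scale[symmetric] by (rule jh_norm_ge[OF S'(1)])
  qed
qed

end

type_synonym JH = "jh_fin cauchy_completion"

end

theory Submission imports Defs begin

text \<open>
  Let \<open>u\<^sub>K\<close> be the uniform distribution on the level \<open>K\<close>. A family of \<open>p\<close>-\<open>q\<close> segments has at most
  \<open>2\<^sup>p\<close> members, and each of them meets the level \<open>K\<close> at most once. Hence signed sums of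
  \<open>u\<^sub>0, u\<^sub>1, \<dots>\<close> have norm at most 2, so that \<open>f(u\<^sub>K) \<rightarrow> 0\<close> for every functional \<open>f\<close>; and if \<open>x\<close> is
  finitely supported of norm less than 1, then \<open>\<parallel>x \<plusminus> u\<^sub>K\<parallel> \<le> 1\<close> for large \<open>K\<close>. Thus the points
  \<open>x\<^sub>i \<plusminus> u\<^sub>K\<close> lie in prescribed slices, and the corresponding convex combinations differ by \<open>2 u\<^sub>K\<close>.
  Dually, the sum of the coordinates over the level \<open>K\<close> is a functional \<open>\<phi>\<^sub>K\<close> with
  \<open>\<phi>\<^sub>K(x) = 0\<close> and \<open>\<phi>\<^sub>K(u\<^sub>K) = 1\<close>, and testing \<open>c \<phi>\<^sub>K + y\<close> at \<open>x \<plusminus> u\<^sub>K\<close> gives octahedrality, where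
  compactness of the unit sphere of a finite-dimensional subspace provides uniformity in \<open>y\<close>.
\<close>

section \<open>Finite-dimensional subspaces\<close>

text \<open>Bolzano-Weierstrass by induction on the generators. A new generator \<open>b\<close>
  outside \<open>span B\<close> has positive distance from it, which bounds the
  \<open>b\<close>-coefficients; the remainders in \<open>span B\<close> are then bounded and the
  induction hypothesis applies to them.\<close>

lemma span_finite_bounded_seq_convergent:
  fixes B :: "'a::real_normed_vector set"
  assumes "finite B" "\<And>n. X n \<in> span B" "\<And>n. norm (X n) \<le> M"
  shows "\<exists>l\<in>span B. \<exists>r::nat\<Rightarrow>nat. strict_mono r \<and> (X \<circ> r) \<longlonglongrightarrow> l"
  using assms
proof (induction B arbitrary: X M rule: finite_induct)
  case empty
  then have "X = (\<lambda>_. 0)" by auto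
  then show ?case by (auto intro!: exI[of _ id] simp: strict_mono_def o_def)
next
  case (insert b B)
  show ?case
  proof (cases "b \<in> span B")
    case True
    then show ?thesis using insert by (metis span_redundant)
  next
    case False
    \<comment> \<open>A convergent sequence in \<open>span B\<close> is bounded, so by the induction
      hypothesis a subsequence converges inside \<open>span B\<close>, necessarily to the same
      limit.\<close>
    have "closed (span B)"
    proof (subst closed_sequential_limits, safe)
      fix Y l assume Y: "\<forall>n. Y n \<in> span B" and l: "Y \<longlonglongrightarrow> l"
      obtain M' where "\<And>n. norm (Y n) \<le> M'"
        using convergent_imp_Bseq[OF convergentI[OF l]] by (auto simp: Bseq_def)
      then obtain l' and r :: "nat \<Rightarrow> nat"
        where l': "l' \<in> span B" "strict_mono r" "(Y \<circ> r) \<longlonglongrightarrow> l'"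
        using insert.IH[of Y M'] Y by blast
      moreover have "l = l'"
        using LIMSEQ_unique[OF LIMSEQ_subseq_LIMSEQ[OF l l'(2)] l'(3)] .
      ultimately show "l \<in> span B" by simp
    qed
    then obtain d where "d > 0" "ball b d \<subseteq> - span B"
      using False open_contains_ball[of "- span B"] by (auto simp: open_Compl)
    then have d: "d > 0" "\<And>z. z \<in> span B \<Longrightarrow> d \<le> dist b z"
      by (auto simp: subset_iff not_less)
    have "\<forall>n. \<exists>a. X n - a *\<^sub>R b \<in> span B"
      using insert.prems(1) span_breakdown_eq by blast
    then obtain a where a: "\<And>n. X n - a n *\<^sub>R b \<in> span B" by metis
    \<comment> \<open>\<open>X n\<close> divided by \<open>a n\<close> is \<open>b\<close> minus an
      element of \<open>span B\<close>, so its norm is at least \<open>d\<close>.\<close>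
    have ad: "\<bar>a n\<bar> * d \<le> norm (X n)" for n
    proof (cases "a n = 0")
      case nz: False
      let ?z = "(- 1 / a n) *\<^sub>R (X n - a n *\<^sub>R b)"
      have "d \<le> norm (b - ?z)" using d(2)[of ?z] a[of n] span_scale dist_norm by metis
      also have "b - ?z = (1 / a n) *\<^sub>R X n" using nz by (simp add: algebra_simps)
      finally have "d \<le> norm (X n) / \<bar>a n\<bar>" by simp
      then show ?thesis using nz by (simp add: field_simps)
    qed simp
    have abound: "\<bar>a n\<bar> \<le> M / d" for n
      using ad[of n] insert.prems(2)[of n] d(1) by (simp add: field_simps)
    then have "bounded (range a)" by (auto simp: bounded_iff)
    then obtain a0 r where r: "strict_mono (r::nat\<Rightarrow>nat)" "(a \<circ> r) \<longlonglongrightarrow> a0"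
      using bounded_imp_convergent_subsequence by blast
    let ?Z = "\<lambda>n. X (r n) - a (r n) *\<^sub>R b"
    have "norm (?Z n) \<le> M + M / d * norm b" for n
      using norm_triangle_ineq4[of "X (r n)" "a (r n) *\<^sub>R b"] insert.prems(2)[of "r n"]
        mult_right_mono[OF abound[of "r n"] norm_ge_zero[of b]] by simp
    then obtain l r' where l: "l \<in> span B" "strict_mono (r'::nat\<Rightarrow>nat)" "(?Z \<circ> r') \<longlonglongrightarrow> l"
      using insert.IH[of ?Z] a by blast
    have "(\<lambda>n. (?Z \<circ> r') n + ((a \<circ> r) \<circ> r') n *\<^sub>R b) \<longlonglongrightarrow> l + a0 *\<^sub>R b"
      by (intro tendsto_intros l(3) LIMSEQ_subseq_LIMSEQ[OF r(2) l(2)])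
    then have "(X \<circ> (r \<circ> r')) \<longlonglongrightarrow> l + a0 *\<^sub>R b" by (simp add: o_def)
    moreover have "l + a0 *\<^sub>R b \<in> span (insert b B)"
      using l(1) by (auto simp: span_breakdown_eq intro!: exI[of _ a0])
    moreover have "strict_mono (r \<circ> r')" using r(1) l(2) strict_mono_o by blast
    ultimately show ?thesis by blast
  qed
qed

lemma compact_sphere_finite_dim_subspace:
  fixes Y :: "'a::real_normed_vector set"
  assumes "finite_dim_subspace Y"
  shows "compact (Y \<inter> sphere 0 1)"
  unfolding compact_def
proof safe
  fix f :: "nat \<Rightarrow> 'a" assume f: "\<forall>n. f n \<in> Y \<inter> sphere 0 1"
  obtain B where B: "finite B" "Y = span B"
    using assms unfolding finite_dim_subspace_def by blast
  have n: "norm (f k) = 1" for k using f by auto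
  obtain l r where l: "l \<in> Y" "strict_mono (r::nat\<Rightarrow>nat)" "(f \<circ> r) \<longlonglongrightarrow> l"
    using span_finite_bounded_seq_convergent[OF B(1), of f 1] f n B(2) by (auto simp: eq_refl)
  have "(\<lambda>k. norm ((f \<circ> r) k)) \<longlonglongrightarrow> norm l" by (intro tendsto_norm l)
  then have "norm l = 1" by (simp add: n LIMSEQ_const_iff)
  with l show "\<exists>l\<in>Y \<inter> sphere 0 1. \<exists>r. strict_mono r \<and> (f \<circ> r) \<longlonglongrightarrow> l" by auto
qed


section \<open>Functionals on the completion\<close>

lemma blinfun_Cauchy_tendsto_lim:
  fixes f :: "'a::real_normed_vector \<Rightarrow>\<^sub>L 'b::banach"
  assumes "Cauchy X"
  shows "(\<lambda>n. blinfun_apply f (X n)) \<longlonglongrightarrow> lim (\<lambda>n. blinfun_apply f (X n))"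
  using bounded_linear.Cauchy[OF blinfun.bounded_linear_right assms]
  by (metis Cauchy_convergent convergent_LIMSEQ_iff)

text \<open>The continuous extension of \<open>f\<close> along the dense embedding
  \<open>to_completion\<close>. Equivalent Cauchy sequences give the same limit because
  \<open>f\<close> sends null sequences to null sequences.\<close>

lift_definition extend_completion ::
  "('a::real_normed_vector \<Rightarrow>\<^sub>L 'b::banach) \<Rightarrow> 'a cauchy_completion \<Rightarrow> 'b"
  is "\<lambda>f X. lim (\<lambda>n. blinfun_apply f (X n))"
proof -
  fix f :: "'a \<Rightarrow>\<^sub>L 'b" and X Y :: "nat \<Rightarrow> 'a"
  assume *: "Cauchy X \<and> Cauchy Y \<and> (\<lambda>n. X n - Y n) \<longlonglongrightarrow> 0"
  then have "(\<lambda>n. blinfun_apply f (X n)) \<longlonglongrightarrow> lim (\<lambda>n. blinfun_apply f (X n))"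
    by (intro blinfun_Cauchy_tendsto_lim) simp
  moreover have "(\<lambda>n. blinfun_apply f (X n - Y n)) \<longlonglongrightarrow> blinfun_apply f 0"
    using * by (intro blinfun.tendsto tendsto_const) auto
  ultimately have "(\<lambda>n. blinfun_apply f (X n) - blinfun_apply f (X n - Y n)) \<longlonglongrightarrow>
      lim (\<lambda>n. blinfun_apply f (X n)) - blinfun_apply f 0"
    by (rule tendsto_diff)
  then show "lim (\<lambda>n. blinfun_apply f (X n)) = lim (\<lambda>n. blinfun_apply f (Y n))"
    by (simp add: blinfun.bilinear_simps limI)
qed

lemma extend_completion_to_completion [simp]:
  "extend_completion f (to_completion x) = blinfun_apply f x"
  by transfer simp

lemma norm_extend_completion_le:
  fixes f :: "'a::real_normed_vector \<Rightarrow>\<^sub>L 'b::banach"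
  shows "norm (extend_completion f x) \<le> norm f * norm x"
proof (transfer fixing: f, elim conjE)
  fix X :: "nat \<Rightarrow> 'a"
  assume X: "Cauchy X"
  have "(\<lambda>n. norm (X n)) \<longlonglongrightarrow> lim (\<lambda>n. norm (X n))"
    using Cauchy_norm_convergent[OF X] by (simp add: convergent_LIMSEQ_iff)
  then have 1: "(\<lambda>n. norm f * norm (X n)) \<longlonglongrightarrow> norm f * lim (\<lambda>n. norm (X n))"
    by (intro tendsto_intros)
  have 2: "(\<lambda>n. norm (blinfun_apply f (X n))) \<longlonglongrightarrow> norm (lim (\<lambda>n. blinfun_apply f (X n)))"
    by (rule tendsto_norm[OF blinfun_Cauchy_tendsto_lim[OF X]])
  show "norm (lim (\<lambda>n. blinfun_apply f (X n))) \<le> norm f * lim (\<lambda>n. norm (X n))"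
    using LIMSEQ_le[OF 2 1] norm_blinfun by blast
qed

lemma bounded_linear_extend_completion: "bounded_linear (extend_completion f)"
proof (rule bounded_linear_intro[where K="norm f"])
  show "extend_completion f (x + y) = extend_completion f x + extend_completion f y" for x y
  proof (transfer, elim conjE)
    fix f :: "'a \<Rightarrow>\<^sub>L 'b" and X Y :: "nat \<Rightarrow> 'a"
    assume "Cauchy X" "Cauchy Y"
    from tendsto_add[OF this[THEN blinfun_Cauchy_tendsto_lim[of _ f]]]
    show "lim (\<lambda>n. blinfun_apply f (X n + Y n)) =
        lim (\<lambda>n. blinfun_apply f (X n)) + lim (\<lambda>n. blinfun_apply f (Y n))"
      by (simp add: blinfun.bilinear_simps limI)
  qed
  show "extend_completion f (c *\<^sub>R x) = c *\<^sub>R extend_completion f x" for c x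
  proof (transfer, elim conjE)
    fix f :: "'a \<Rightarrow>\<^sub>L 'b" and c and X :: "nat \<Rightarrow> 'a"
    assume "Cauchy X"
    from tendsto_scaleR[OF tendsto_const[of c] blinfun_Cauchy_tendsto_lim[OF this, of f]]
    show "lim (\<lambda>n. blinfun_apply f (c *\<^sub>R X n)) = c *\<^sub>R lim (\<lambda>n. blinfun_apply f (X n))"
      by (simp add: blinfun.bilinear_simps limI)
  qed
  show "norm (extend_completion f x) \<le> norm x * norm f" for x
    using norm_extend_completion_le[of f x] by (simp add: mult.commute)
qed

text \<open>Shrinking \<open>x\<close> slightly keeps the strict inequality and moves the point into
  the open unit ball. Both conditions are then open, so the dense image of
  \<open>to_completion\<close> meets them. The strict bound on \<open>norm z\<close> leaves room for
  adding a small perturbation.\<close>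

lemma blinfun_gt_in_ball_to_completion:
  fixes f :: "'a::real_normed_vector cauchy_completion \<Rightarrow>\<^sub>L real"
  assumes "norm x \<le> 1" "a < blinfun_apply f x"
  obtains z where "norm z < 1" "a < blinfun_apply f (to_completion z)"
proof -
  have "((\<lambda>t. blinfun_apply f (t *\<^sub>R x)) \<longlongrightarrow> blinfun_apply f (1 *\<^sub>R x)) (at_left (1::real))"
    by (intro tendsto_intros)
  then have "\<forall>\<^sub>F t in at_left 1. a < blinfun_apply f (t *\<^sub>R x)"
    using assms(2) order_tendstoD(1) by fastforce
  moreover have "\<forall>\<^sub>F t in at_left (1::real). t \<in> {0<..<1}"
    by (intro eventually_at_left_real) simp
  ultimately have "\<forall>\<^sub>F t in at_left 1. a < blinfun_apply f (t *\<^sub>R x) \<and> t \<in> {0<..<1::real}"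
    by (rule eventually_conj)
  then obtain t where t: "a < blinfun_apply f (t *\<^sub>R x)" "0 < t" "t < 1"
    using eventually_happens'[of "at_left (1::real)"] by fastforce
  have "norm (t *\<^sub>R x) \<le> t * 1" using assms(1) t by simp
  then have n: "norm (t *\<^sub>R x) < 1" using t by linarith
  let ?U = "ball 0 1 \<inter> {y. a < blinfun_apply f y}"
  have "open ?U" by (intro open_Int open_ball open_Collect_less continuous_intros)
  moreover have "t *\<^sub>R x \<in> ?U" using t n by simp
  ultimately have "?U \<inter> range to_completion \<noteq> {}"
    using open_Int_closure_eq_empty[of ?U "range to_completion"] closure_range_to_completion
    by blast
  then obtain z where "to_completion z \<in> ?U" by blast
  then show thesis using that[of z] by (simp add: norm_to_completion)
qed


section \<open>Segments and families\<close>

text \<open>Each offspring lies one level deeper, so the \<open>j\<close>-th node of the list has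
  level \<open>p + j\<close>.\<close>

lemma segment_levels:
  assumes "segment p q S"
  shows "inj_on fst S" "fst ` S \<subseteq> {p..q}" "S \<inter> level p \<noteq> {}"
proof -
  obtain ts where ts: "ts \<noteq> []" "S = set ts" "hd ts \<in> level p" "last ts \<in> level q"
    and off: "\<And>j. Suc j < length ts \<Longrightarrow> ts ! Suc j \<in> offspring (ts ! j)"
    using assms unfolding segment_def by blast
  have f: "fst (ts ! j) = p + j" if "j < length ts" for j
    using that
  proof (induction j)
    case 0
    then show ?case using ts(1,3) by (auto simp: hd_conv_nth level_def)
  next
    case (Suc j)
    then show ?case using off[of j] by (auto simp: offspring_def)
  qed
  have q: "q = p + (length ts - 1)"
    using f[of "length ts - 1"] ts(1,4) by (auto simp: last_conv_nth level_def)
  show "inj_on fst S"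
    unfolding ts(2) by (intro inj_onI) (metis add_left_cancel f in_set_conv_nth)
  show "fst ` S \<subseteq> {p..q}"
  proof
    fix k assume "k \<in> fst ` S"
    then obtain j where "j < length ts" "k = fst (ts ! j)" by (auto simp: ts(2) in_set_conv_nth)
    then show "k \<in> {p..q}" using f[of j] q by auto
  qed
  show "S \<inter> level p \<noteq> {}" using ts by (auto intro: hd_in_set)
qed

lemma finite_level: "finite (level n)" and card_level: "card (level n) = 2 ^ n"
proof -
  have "level n = Pair n ` {..<2 ^ n}" by (auto simp: level_def)
  then show "finite (level n)" "card (level n) = 2 ^ n"
    by (simp_all add: card_image inj_on_def)
qed

text \<open>Disjoint segments meet the level \<open>p\<close> in distinct nodes.\<close>

lemma card_family_le:
  assumes "disjoint \<S>" "\<And>S. S \<in> \<S> \<Longrightarrow> segment p q S"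
  shows "card \<S> \<le> 2 ^ p"
proof -
  have "\<forall>S\<in>\<S>. \<exists>t. t \<in> S \<inter> level p"
    using segment_levels(3)[OF assms(2)] by blast
  then obtain g where g: "\<And>S. S \<in> \<S> \<Longrightarrow> g S \<in> S \<inter> level p"
    by metis
  have "inj_on g \<S>"
  proof (rule inj_onI)
    fix S S' assume "S \<in> \<S>" "S' \<in> \<S>" "g S = g S'"
    then have "S \<inter> S' \<noteq> {}" using g[of S] g[of S'] by auto
    then show "S = S'" using assms(1) \<open>S \<in> \<S>\<close> \<open>S' \<in> \<S>\<close> by (meson disjointD)
  qed
  moreover have "g ` \<S> \<subseteq> level p" using g by auto
  ultimately show ?thesis
    using card_inj_on_le[of g \<S> "level p"] by (simp add: finite_level card_level)
qed

lemma abs_sum_segment_le: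
  assumes "segment p q S" "\<And>t. \<bar>x t\<bar> \<le> a (fst t)"
  shows "\<bar>\<Sum>t\<in>S. x t\<bar> \<le> (\<Sum>k\<in>{p..q}. a k :: real)"
proof -
  have a: "a k \<ge> 0" for k using assms(2)[of "(k, 0)"] by simp
  have "\<bar>\<Sum>t\<in>S. x t\<bar> \<le> (\<Sum>t\<in>S. a (fst t))"
    using assms(2) by (intro order_trans[OF sum_abs] sum_mono)
  also have "\<dots> = (\<Sum>k\<in>fst ` S. a k)"
    using segment_levels(1)[OF assms(1)] by (simp add: sum.reindex)
  also have "\<dots> \<le> (\<Sum>k\<in>{p..q}. a k)"
    using segment_levels(2)[OF assms(1)] a by (intro sum_mono2) auto
  finally show ?thesis .
qed

text \<open>\<open>a\<close> is a levelwise majorant: one segment collects at most one value per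
  level, and at most \<open>2 ^ p\<close> segments occur. A majorant decaying like
  \<open>2 ^ k\<close> in the denominator thus compensates the number of segments.\<close>

lemma family_sum_le:
  assumes "disjoint \<S>" "\<And>S. S \<in> \<S> \<Longrightarrow> segment p q S" "\<And>t. \<bar>x t\<bar> \<le> a (fst t)"
  shows "(\<Sum>S\<in>\<S>. \<bar>\<Sum>t\<in>S. x t\<bar>) \<le> 2 ^ p * (\<Sum>k\<in>{p..q}. a k :: real)"
proof -
  have a: "a k \<ge> 0" for k using assms(3)[of "(k, 0)"] by simp
  have "(\<Sum>S\<in>\<S>. \<bar>\<Sum>t\<in>S. x t\<bar>) \<le> of_nat (card \<S>) * (\<Sum>k\<in>{p..q}. a k)"
    using assms by (intro sum_bounded_above abs_sum_segment_le)
  also have "\<dots> \<le> 2 ^ p * (\<Sum>k\<in>{p..q}. a k)"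
    using card_family_le[OF assms(1,2)]
    by (intro mult_right_mono sum_nonneg a) (metis of_nat_le_iff of_nat_numeral of_nat_power)
  finally show ?thesis .
qed

lemma jh_norm_leI:
  assumes "\<And>\<S> p q. finite \<S> \<Longrightarrow> disjoint \<S> \<Longrightarrow> (\<And>S. S \<in> \<S> \<Longrightarrow> segment p q S) \<Longrightarrow>
    (\<Sum>S\<in>\<S>. \<bar>\<Sum>t\<in>S. jh_coord x t\<bar>) \<le> C"
  shows "norm x \<le> C"
proof -
  obtain \<S> where \<S>: "admissible \<S>" "norm x = (\<Sum>S\<in>\<S>. \<bar>\<Sum>t\<in>S. jh_coord x t\<bar>)"
    by (rule jh_norm_attained)
  then obtain p q where "finite \<S>" "disjoint \<S>" "\<And>S. S \<in> \<S> \<Longrightarrow> segment p q S"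
    unfolding admissible_def by blast
  then show ?thesis unfolding \<S>(2) by (rule assms)
qed


section \<open>Uniform distributions on the levels\<close>

lift_definition jh_unif :: "nat \<Rightarrow> jh_fin" is "\<lambda>K t. if t \<in> level K then 1 / 2 ^ K else 0"
proof -
  fix K
  let ?D = "{t. (if t \<in> level K then 1 / 2 ^ K else 0 :: real) \<noteq> 0}"
  have "?D \<subseteq> level K" by auto
  then show "finite ?D \<and> ?D \<subseteq> dyadic_tree"
    using finite_subset[OF _ finite_level] by (auto simp: level_def dyadic_tree_def)
qed

lemma abs_jh_coord_unif_le: "\<bar>jh_coord (jh_unif K) t\<bar> \<le> (if fst t = K then 1 / 2 ^ K else 0)"
  by (auto simp: jh_unif.rep_eq level_def)

text \<open>The bound 1 is for families starting below the support of a given vector, the bound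
  \<open>2 ^ p / 2 ^ K\<close> for those starting at a small level \<open>p\<close>, where it is
  negligible for large \<open>K\<close>.\<close>

lemma unif_family_sum_le:
  assumes "disjoint \<S>" "\<And>S. S \<in> \<S> \<Longrightarrow> segment p q S"
  shows "(\<Sum>S\<in>\<S>. \<bar>\<Sum>t\<in>S. jh_coord (jh_unif K) t\<bar>) \<le> min 1 (2 ^ p / 2 ^ K)"
proof -
  have "(\<Sum>S\<in>\<S>. \<bar>\<Sum>t\<in>S. jh_coord (jh_unif K) t\<bar>)
      \<le> 2 ^ p * (\<Sum>k\<in>{p..q}. if k = K then 1 / 2 ^ K else 0)"
    by (intro family_sum_le assms abs_jh_coord_unif_le)
  \<comment> \<open>The sum over \<open>k\<close> vanishes unless \<open>p \<le> K\<close>, and in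
    that case \<open>2 ^ p / 2 ^ K\<close> is at most 1.\<close>
  also have "\<dots> \<le> min 1 (2 ^ p / 2 ^ K)" by simp
  finally show ?thesis .
qed

lemma norm_unif_le: "norm (jh_unif K) \<le> 1"
  by (rule jh_norm_leI, rule order_trans[OF unif_family_sum_le]) auto

lemma jh_coord_sum: "jh_coord (sum x A) t = (\<Sum>i\<in>A. jh_coord (x i) t)"
  by (induction A rule: infinite_finite_induct)
    (simp_all add: zero_jh_fin.rep_eq plus_jh_fin.rep_eq)

text \<open>The summands live on different levels, so the coordinates at level \<open>k\<close> are
  at most \<open>(1 / 2) ^ k\<close> in modulus. From level \<open>p\<close> on, a segment collects
  at most the geometric tail \<open>2 * (1 / 2) ^ p\<close>, and the factor \<open>2 ^ p\<close>
  cancels.\<close>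

lemma norm_sum_signed_unif_le:
  assumes "\<And>k. \<bar>s k\<bar> \<le> 1"
  shows "norm (\<Sum>k<n. s k *\<^sub>R jh_unif k) \<le> 2"
proof (rule jh_norm_leI)
  fix \<S> p q assume \<S>: "disjoint \<S>" "\<And>S. S \<in> \<S> \<Longrightarrow> segment p q S"
  have "\<bar>jh_coord (\<Sum>k<n. s k *\<^sub>R jh_unif k) t\<bar> \<le> (1 / 2) ^ fst t" for t
  proof -
    have "\<bar>jh_coord (\<Sum>k<n. s k *\<^sub>R jh_unif k) t\<bar> \<le> (\<Sum>k<n. \<bar>s k * jh_coord (jh_unif k) t\<bar>)"
      by (simp add: jh_coord_sum scaleR_jh_fin.rep_eq)
    also have "\<dots> \<le> (\<Sum>k<n. if fst t = k then (1 / 2) ^ k else 0)"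
    proof (rule sum_mono)
      fix k
      have "\<bar>s k\<bar> * \<bar>jh_coord (jh_unif k) t\<bar> \<le> 1 * (if fst t = k then 1 / 2 ^ k else 0)"
        by (intro mult_mono assms abs_jh_coord_unif_le) auto
      then show "\<bar>s k * jh_coord (jh_unif k) t\<bar> \<le> (if fst t = k then (1 / 2) ^ k else 0)"
        by (simp add: abs_mult power_one_over split: if_splits)
    qed
    also have "\<dots> \<le> (1 / 2) ^ fst t" by simp
    finally show ?thesis .
  qed
  then have "(\<Sum>S\<in>\<S>. \<bar>\<Sum>t\<in>S. jh_coord (\<Sum>k<n. s k *\<^sub>R jh_unif k) t\<bar>)
      \<le> 2 ^ p * (\<Sum>k\<in>{p..q}. (1 / 2) ^ k)"
    by (intro family_sum_le \<S>)
  also have "\<dots> \<le> 2 ^ p * (2 * (1 / 2) ^ p)"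
    by (intro mult_left_mono) (simp_all add: sum_gp)
  also have "\<dots> = 2" by (simp add: power_one_over)
  finally show "(\<Sum>S\<in>\<S>. \<bar>\<Sum>t\<in>S. jh_coord (\<Sum>k<n. s k *\<^sub>R jh_unif k) t\<bar>) \<le> 2" .
qed

text \<open>With the signs of the values \<open>?v k\<close> as coefficients, the partial sums of
  their moduli become values of \<open>f\<close> at vectors of norm at most 2. So the values are
  absolutely summable.\<close>

lemma functional_unif_tendsto_0:
  fixes f :: "JH \<Rightarrow>\<^sub>L real"
  shows "(\<lambda>K. blinfun_apply f (to_completion (jh_unif K))) \<longlonglongrightarrow> 0"
proof -
  let ?v = "\<lambda>K. blinfun_apply f (to_completion (jh_unif K))"
  have "(\<Sum>K<n. \<bar>?v K\<bar>) \<le> norm f * 2" for n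
  proof -
    let ?w = "\<Sum>k<n. sgn (?v k) *\<^sub>R jh_unif k"
    have "(\<Sum>K<n. \<bar>?v K\<bar>) = blinfun_apply f (to_completion ?w)"
      by (simp add: linear_sum[OF linear_to_completion] to_completion_scaleR
          blinfun.bilinear_simps abs_sgn mult.commute)
    also have "\<dots> \<le> norm f * norm (to_completion ?w)"
      using norm_blinfun[of f "to_completion ?w"] by simp
    also have "\<dots> \<le> norm f * 2"
      unfolding norm_to_completion
      by (intro mult_left_mono norm_sum_signed_unif_le) (simp_all add: abs_sgn_eq)
    finally show ?thesis .
  qed
  then have "summable (\<lambda>K. \<bar>?v K\<bar>)" by (intro summableI_nonneg_bounded) auto
  then show ?thesis using summable_LIMSEQ_zero tendsto_rabs_zero_iff by blast
qed

lemma jh_fin_bounded_level: "\<exists>N. \<forall>t. fst t \<ge> N \<longrightarrow> jh_coord x t = 0"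
proof -
  have "finite (fst ` {t. jh_coord x t \<noteq> 0})" using jh_coord[of x] by simp
  then obtain N where "\<forall>n\<in>fst ` {t. jh_coord x t \<noteq> 0}. n < N"
    by (metis finite_nat_set_iff_bounded)
  then show ?thesis by (intro exI[of _ N]) (force simp: not_less[symmetric])
qed

lemma eventually_norm_add_unif_le:
  assumes x: "norm x < 1" and s: "\<bar>s\<bar> \<le> 1"
  shows "\<forall>\<^sub>F K in sequentially. norm (x + s *\<^sub>R jh_unif K) \<le> 1"
proof -
  obtain N where N: "\<And>t. fst t \<ge> N \<Longrightarrow> jh_coord x t = 0"
    using jh_fin_bounded_level by blast
  have "(\<lambda>K. 2 ^ N * (1 / 2) ^ K) \<longlonglongrightarrow> 2 ^ N * (0::real)"
    by (intro tendsto_intros LIMSEQ_power_zero) simp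
  \<comment> \<open>\<open>K\<close> is taken so large that families starting above level
    \<open>N\<close> see less of \<open>jh_unif K\<close> than the slack
    \<open>1 - norm x\<close>.\<close>
  then have "\<forall>\<^sub>F K in sequentially. 2 ^ N * (1 / 2) ^ K < 1 - norm x"
    using x by (intro order_tendstoD(2)[of _ "2 ^ N * 0"]) simp_all
  then show ?thesis
  proof eventually_elim
    case (elim K)
    show ?case
    proof (rule jh_norm_leI)
      fix \<S> p q assume \<S>: "finite \<S>" "disjoint \<S>" "\<And>S. S \<in> \<S> \<Longrightarrow> segment p q S"
      let ?X = "\<Sum>S\<in>\<S>. \<bar>\<Sum>t\<in>S. jh_coord x t\<bar>"
      let ?U = "\<Sum>S\<in>\<S>. \<bar>\<Sum>t\<in>S. jh_coord (jh_unif K) t\<bar>"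
      have "\<bar>a + s * b\<bar> \<le> \<bar>a\<bar> + \<bar>b\<bar>" for a b
        using abs_triangle_ineq[of a "s * b"] mult_right_mono[OF s abs_ge_zero[of b]]
        by (simp add: abs_mult)
      then have "(\<Sum>S\<in>\<S>. \<bar>\<Sum>t\<in>S. jh_coord (x + s *\<^sub>R jh_unif K) t\<bar>) \<le> ?X + ?U"
        unfolding sum.distrib[symmetric]
        by (intro sum_mono)
          (simp add: plus_jh_fin.rep_eq scaleR_jh_fin.rep_eq sum.distrib sum_distrib_left[symmetric])
      also have "\<dots> \<le> 1"
      proof (cases "p < N")
        case True
        have "?X \<le> norm x"
        \<comment> \<open>Admissibility asks for \<open>p \<le> q\<close>, which any member of the
          family supplies; the empty family has sum 0.\<close>
        proof (cases "\<S> = {}")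
          case False
          then obtain S where "S \<in> \<S>" by blast
          from segment_levels(2,3)[OF \<S>(3)[OF this]] have "p \<le> q" by fastforce
          then have "admissible \<S>" using \<S> unfolding admissible_def by blast
          then show ?thesis by (rule jh_norm_ge)
        qed simp
        moreover have "?U \<le> 2 ^ p / 2 ^ K" using unif_family_sum_le[OF \<S>(2,3)] by simp
        moreover have "(2::real) ^ p / 2 ^ K \<le> 2 ^ N * (1 / 2) ^ K"
          using True by (simp add: power_one_over divide_right_mono)
        ultimately show ?thesis using elim by linarith
      next
        case False
        \<comment> \<open>These segments start at level \<open>N\<close> or deeper and miss the
          support of \<open>x\<close>, so only \<open>jh_unif K\<close> contributes.\<close>
        have "\<bar>\<Sum>t\<in>S. jh_coord x t\<bar> = 0" if "S \<in> \<S>" for S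
          using segment_levels(2)[OF \<S>(3)[OF that]] False N by (fastforce intro!: sum.neutral)
        then have "?X = 0" by simp
        moreover have "?U \<le> 1" using unif_family_sum_le[OF \<S>(2,3)] by simp
        ultimately show ?thesis by simp
      qed
      finally show "(\<Sum>S\<in>\<S>. \<bar>\<Sum>t\<in>S. jh_coord (x + s *\<^sub>R jh_unif K) t\<bar>) \<le> 1" .
    qed
  qed
qed


section \<open>Level functionals\<close>

text \<open>The singletons of the nodes of level \<open>K\<close> form an admissible family of
  \<open>K\<close>-\<open>K\<close> segments.\<close>

lemma sum_level_le_norm: "(\<Sum>t\<in>level K. \<bar>jh_coord x t\<bar>) \<le> norm x"
proof -
  have adm: "admissible ((\<lambda>t. {t}) ` level K)"
  proof -
    have "segment K K {t}" if "t \<in> level K" for t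
      using segment_singleton[of t] that by (auto simp: level_def dyadic_tree_def)
    then show ?thesis
      unfolding admissible_def by (auto simp: finite_level disjoint_def intro!: exI[of _ K])
  qed
  show ?thesis using jh_norm_ge[OF adm, of x] by (simp add: sum.reindex inj_on_def)
qed

lift_definition jh_level_sum :: "nat \<Rightarrow> jh_fin \<Rightarrow>\<^sub>L real" is "\<lambda>K x. \<Sum>t\<in>level K. jh_coord x t"
proof (rule bounded_linear_intro[where K=1])
  show "norm (\<Sum>t\<in>level K. jh_coord x t) \<le> norm x * 1" for K x
    using order_trans[OF sum_abs sum_level_le_norm] by simp
qed (simp_all add: plus_jh_fin.rep_eq scaleR_jh_fin.rep_eq sum.distrib sum_distrib_left)

definition level_functional :: "nat \<Rightarrow> (JH \<Rightarrow>\<^sub>L real)" where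
  "level_functional K = Blinfun (extend_completion (jh_level_sum K))"

lemma level_functional_to_completion:
  "blinfun_apply (level_functional K) (to_completion x) = (\<Sum>t\<in>level K. jh_coord x t)"
  by (simp add: level_functional_def bounded_linear_Blinfun_apply bounded_linear_extend_completion
      jh_level_sum.rep_eq)

lemma level_functional_unif:
  "blinfun_apply (level_functional K) (to_completion (jh_unif K)) = 1"
  by (simp add: level_functional_to_completion jh_unif.rep_eq card_level)

lemma norm_unif: "norm (jh_unif K) = 1"
proof (rule antisym[OF norm_unif_le])
  show "1 \<le> norm (jh_unif K)"
    using sum_level_le_norm[of "jh_unif K" K] by (simp add: jh_unif.rep_eq card_level)
qed

lemma norm_level_functional: "norm (level_functional K) = 1"
proof (rule antisym)
  have "norm (blinfun_apply (jh_level_sum K) x) \<le> 1 * norm x" for x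
    using order_trans[OF sum_abs sum_level_le_norm] by (simp add: jh_level_sum.rep_eq)
  then have "norm (jh_level_sum K) \<le> 1" by (intro norm_blinfun_bound) simp_all
  then have "norm (extend_completion (jh_level_sum K) x) \<le> 1 * norm x" for x
    using norm_extend_completion_le mult_right_mono norm_ge_zero order_trans by metis
  then show "norm (level_functional K) \<le> 1"
    by (intro norm_blinfun_bound)
      (simp_all add: level_functional_def bounded_linear_Blinfun_apply
        bounded_linear_extend_completion)
  show "1 \<le> norm (level_functional K)"
    using norm_blinfun[of "level_functional K" "to_completion (jh_unif K)"]
    by (simp add: level_functional_unif norm_to_completion norm_unif)
qed

lemma level_functional_eventually_0:
  "\<forall>\<^sub>F K in sequentially. blinfun_apply (level_functional K) (to_completion x) = 0"
proof -
  obtain N where "\<And>t. fst t \<ge> N \<Longrightarrow> jh_coord x t = 0"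
    using jh_fin_bounded_level by blast
  then show ?thesis
    unfolding eventually_sequentially level_functional_to_completion
    by (intro exI[of _ N] allI impI sum.neutral) (auto simp: level_def)
qed

text \<open>If all values on the ball were at most \<open>norm y - e\<close>, homogeneity applied to
  \<open>x\<close> and \<open>- x\<close> would make \<open>norm y - e\<close> a bound for the
  operator norm.\<close>

lemma blinfun_almost_norming:
  fixes y :: "'a::real_normed_vector \<Rightarrow>\<^sub>L real"
  assumes "e > 0"
  shows "\<exists>x. norm x \<le> 1 \<and> norm y - e < blinfun_apply y x"
proof (rule ccontr)
  assume "\<not> ?thesis"
  then have le: "blinfun_apply y x \<le> norm y - e" if "norm x \<le> 1" for x
    using that by (meson not_less)
  have "norm y \<le> norm y - e"
  proof (rule norm_blinfun_bound)
    show "0 \<le> norm y - e" using le[of 0] by simp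
    fix x
    show "norm (blinfun_apply y x) \<le> (norm y - e) * norm x"
    proof (cases "x = 0")
      case False
      have *: "blinfun_apply y z \<le> (norm y - e) * norm z" if "z \<noteq> 0" for z
        using le[of "z /\<^sub>R norm z"] that by (simp add: blinfun.bilinear_simps field_simps)
      show ?thesis using *[of x] *[of "- x"] False by (simp add: blinfun.bilinear_simps)
    qed simp
  qed
  then show False using assms by simp
qed

text \<open>\<open>K\<close> can be chosen before \<open>c\<close>, since the test vector depends on
  \<open>c\<close> only through its sign. Half of \<open>e\<close> pays for \<open>x\<close> almost
  norming \<open>y\<close>, the other half for the value of \<open>y\<close> at
  \<open>jh_unif K\<close>.\<close>

lemma eventually_norm_level_functional_add_ge:
  fixes y :: "JH \<Rightarrow>\<^sub>L real"
  assumes "e > 0"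
  shows "\<forall>\<^sub>F K in sequentially. \<forall>c. \<bar>c\<bar> + norm y - e \<le> norm (c *\<^sub>R level_functional K + y)"
proof -
  obtain x0 where "norm x0 \<le> 1" "norm y - e / 2 < blinfun_apply y x0"
    using blinfun_almost_norming[of "e / 2" y] assms by auto
  then obtain x where x: "norm x < 1" "norm y - e / 2 < blinfun_apply y (to_completion x)"
    by (rule blinfun_gt_in_ball_to_completion)
  have "(\<lambda>K. \<bar>blinfun_apply y (to_completion (jh_unif K))\<bar>) \<longlonglongrightarrow> 0"
    using functional_unif_tendsto_0 by (rule tendsto_rabs_zero)
  then have "\<forall>\<^sub>F K in sequentially. \<bar>blinfun_apply y (to_completion (jh_unif K))\<bar> < e / 2"
    using assms by (intro order_tendstoD(2)) auto
  moreover have "\<forall>\<^sub>F K in sequentially. norm (x + 1 *\<^sub>R jh_unif K) \<le> 1"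
    "\<forall>\<^sub>F K in sequentially. norm (x + (-1) *\<^sub>R jh_unif K) \<le> 1"
    by (intro eventually_norm_add_unif_le x(1); simp)+
  ultimately show ?thesis using level_functional_eventually_0[of x]
  proof eventually_elim
    case (elim K)
    show ?case
    proof
      fix c :: real
      \<comment> \<open>This gives \<open>c * s = \<bar>c\<bar>\<close>, the contribution of the
        level functional at \<open>?z\<close>, because that functional is 0 at \<open>x\<close> and
        1 at \<open>jh_unif K\<close>.\<close>
      define s :: real where "s = (if c \<ge> 0 then 1 else -1)"
      let ?z = "to_completion (x + s *\<^sub>R jh_unif K)" and ?g = "c *\<^sub>R level_functional K + y"
      have n: "norm ?z \<le> 1" using elim(2,3) by (simp add: norm_to_completion s_def)
      have "blinfun_apply ?g ?z =
          c * s + blinfun_apply y (to_completion x) + s * blinfun_apply y (to_completion (jh_unif K))"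
        using elim(4)
        by (simp add: blinfun.bilinear_simps to_completion_add to_completion_scaleR
            level_functional_unif algebra_simps)
      also have "\<dots> \<ge> \<bar>c\<bar> + norm y - e" using elim(1) x(2) by (auto simp: s_def)
      finally have "\<bar>c\<bar> + norm y - e \<le> blinfun_apply ?g ?z" .
      also have "\<dots> \<le> norm ?g * norm ?z" using norm_blinfun[of ?g ?z] by simp
      also have "\<dots> \<le> norm ?g" using mult_left_mono[OF n norm_ge_zero[of ?g]] by simp
      finally show "\<bar>c\<bar> + norm y - e \<le> norm ?g" .
    qed
  qed
qed


section \<open>The two properties\<close>

lemma slice_contains_to_completion:
  fixes f :: "'a::real_normed_vector cauchy_completion \<Rightarrow>\<^sub>L real"
  assumes "\<alpha> > 0"
  obtains z where "norm z < 1" "to_completion z \<in> slice (cball 0 1) f \<alpha>"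
proof -
  let ?s = "SUP y\<in>cball 0 1. blinfun_apply f y"
  have "?s - \<alpha> < ?s" using assms by simp
  then obtain x where "x \<in> cball 0 1" "?s - \<alpha> < blinfun_apply f x"
    using less_cSupE[of "?s - \<alpha>" "blinfun_apply f ` cball 0 1"] by force
  then obtain z where "norm z < 1" "?s - \<alpha> < blinfun_apply f (to_completion z)"
    using blinfun_gt_in_ball_to_completion by (metis mem_cball_0)
  then show thesis using that[of z] by (simp add: slice_def norm_to_completion)
qed

lemma strong_diameter_two_JH: "strong_diameter_two TYPE(JH)"
  unfolding strong_diameter_two_def
proof (intro allI impI, elim conjE)
  fix n :: nat and f :: "nat \<Rightarrow> JH \<Rightarrow>\<^sub>L real" and \<alpha> c :: "nat \<Rightarrow> real"
  assume \<alpha>: "\<forall>i<n. 0 < \<alpha> i" and c: "\<forall>i<n. 0 \<le> c i" and c1: "(\<Sum>i<n. c i) = 1"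
  let ?S = "\<lambda>i. slice (cball 0 1) (f i) (\<alpha> i)"
  let ?C = "{(\<Sum>i<n. c i *\<^sub>R x i) | x. \<forall>i<n. x i \<in> ?S i}"
  have "\<exists>z. norm z < 1 \<and> to_completion z \<in> ?S i" if "i < n" for i
    using slice_contains_to_completion \<alpha> that by metis
  then obtain z where z: "\<And>i. i < n \<Longrightarrow> norm (z i) < 1"
      "\<And>i. i < n \<Longrightarrow> to_completion (z i) \<in> ?S i" by metis
  let ?v = "\<lambda>s i K. to_completion (z i + s *\<^sub>R jh_unif K)"
  have ev: "\<forall>\<^sub>F K in sequentially. \<forall>i\<in>{..<n}. ?v s i K \<in> ?S i" if s: "\<bar>s\<bar> \<le> 1" for s :: real
  proof (rule eventually_ball_finite, simp, rule ballI)
    fix i assume "i \<in> {..<n}"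
    then have i: "i < n" by simp
    \<comment> \<open>The inequality defining the slice is strict at \<open>z i\<close>, hence
      survives a perturbation on which \<open>f i\<close> tends to 0.\<close>
    have "(\<lambda>K. blinfun_apply (f i) (to_completion (z i)) +
        s * blinfun_apply (f i) (to_completion (jh_unif K)))
        \<longlonglongrightarrow> blinfun_apply (f i) (to_completion (z i)) + s * 0"
      by (intro tendsto_intros functional_unif_tendsto_0)
    then have "\<forall>\<^sub>F K in sequentially. (SUP y\<in>cball 0 1. blinfun_apply (f i) y) - \<alpha> i <
        blinfun_apply (f i) (to_completion (z i)) +
        s * blinfun_apply (f i) (to_completion (jh_unif K))"
      using z(2)[OF i] by (intro order_tendstoD(1)) (auto simp: slice_def)
    with eventually_norm_add_unif_le[OF z(1)[OF i] s]
    show "\<forall>\<^sub>F K in sequentially. ?v s i K \<in> ?S i"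
    proof eventually_elim
      case (elim K)
      then show ?case
        by (simp add: slice_def norm_to_completion)
          (simp add: to_completion_add to_completion_scaleR blinfun.bilinear_simps)
    qed
  qed
  have "\<forall>\<^sub>F K in sequentially. (\<forall>i\<in>{..<n}. ?v 1 i K \<in> ?S i) \<and> (\<forall>i\<in>{..<n}. ?v (-1) i K \<in> ?S i)"
    by (intro eventually_conj ev) simp_all
  from eventually_happens'[OF sequentially_bot this]
  obtain K where K: "\<forall>i<n. ?v 1 i K \<in> ?S i" "\<forall>i<n. ?v (-1) i K \<in> ?S i"
    by auto
  \<comment> \<open>Convexity of the ball gives the upper bound 2, and also the boundedness that
    lets distances bound \<open>diameter\<close> from below.\<close>
  have sub: "?C \<subseteq> cball 0 1"
  proof safe
    fix x :: "nat \<Rightarrow> JH" assume x: "\<forall>i<n. x i \<in> ?S i"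
    have "norm (\<Sum>i<n. c i *\<^sub>R x i) \<le> (\<Sum>i<n. c i * 1)"
      using x c by (intro sum_norm_le) (auto simp: slice_def intro!: mult_left_le)
    then show "(\<Sum>i<n. c i *\<^sub>R x i) \<in> cball 0 1" using c1 by simp
  qed
  let ?a = "\<lambda>s. \<Sum>i<n. c i *\<^sub>R ?v s i K"
  have mem: "?a 1 \<in> ?C" "?a (-1) \<in> ?C"
    by (intro CollectI exI[of _ "\<lambda>i. ?v 1 i K"] conjI refl K)
      (intro CollectI exI[of _ "\<lambda>i. ?v (-1) i K"] conjI refl K)
  have "?a 1 - ?a (-1) = (\<Sum>i<n. c i *\<^sub>R (2 *\<^sub>R to_completion (jh_unif K)))"
    unfolding sum_subtractf[symmetric]
    by (intro sum.cong)
      (simp_all add: to_completion_add to_completion_diff scaleR_2 flip: scaleR_diff_right)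
  also have "\<dots> = 2 *\<^sub>R to_completion (jh_unif K)"
    using c1 by (simp flip: scaleR_sum_left sum_distrib_right)
  finally have "dist (?a 1) (?a (-1)) = 2"
    by (simp add: dist_norm norm_to_completion norm_unif)
  moreover have "bounded ?C" using sub bounded_cball bounded_subset by blast
  ultimately have "2 \<le> diameter ?C" using diameter_bounded_bound[OF _ mem] by simp
  moreover have "diameter ?C \<le> 2"
  proof (rule diameter_le)
    fix a b assume "a \<in> ?C" "b \<in> ?C"
    then have "norm a \<le> 1" "norm b \<le> 1" using sub by auto
    then show "norm (a - b) \<le> 2" using norm_triangle_ineq4[of a b] by linarith
  qed simp
  ultimately show "diameter ?C = 2" by simp
qed

lemma octahedral_norm_JH_dual: "octahedral_norm TYPE(JH \<Rightarrow>\<^sub>L real)"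
  unfolding octahedral_norm_def
proof (intro allI impI)
  fix \<epsilon> :: real and Y :: "(JH \<Rightarrow>\<^sub>L real) set"
  assume \<epsilon>: "\<epsilon> > 0" and Y: "finite_dim_subspace Y"
  let ?\<phi> = level_functional
  have sub: "subspace Y" using Y unfolding finite_dim_subspace_def by auto
  \<comment> \<open>The lower estimate holds eventually for each single functional; a finite net of
    the sphere lets one \<open>K\<close> serve all its points.\<close>
  obtain A where A: "finite A" "A \<subseteq> Y \<inter> sphere 0 1" "Y \<inter> sphere 0 1 \<subseteq> (\<Union>a\<in>A. ball a (\<epsilon> / 2))"
    using seq_compact_imp_totally_bounded[of "Y \<inter> sphere 0 1"] \<epsilon>
      compact_imp_seq_compact[OF compact_sphere_finite_dim_subspace[OF Y]]
    by (meson half_gt_zero)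
  have "\<forall>\<^sub>F K in sequentially. \<forall>a\<in>A. \<forall>c. \<bar>c\<bar> + norm a - \<epsilon> / 2 \<le> norm (c *\<^sub>R ?\<phi> K + a)"
    using \<epsilon> by (intro eventually_ball_finite A ballI eventually_norm_level_functional_add_ge) simp
  then obtain K where K: "\<And>a c. a \<in> A \<Longrightarrow> \<bar>c\<bar> + norm a - \<epsilon> / 2 \<le> norm (c *\<^sub>R ?\<phi> K + a)"
    using eventually_happens'[OF sequentially_bot] by blast
  have unit: "(1 - \<epsilon>) * (\<bar>c\<bar> + 1) \<le> norm (c *\<^sub>R ?\<phi> K + y)" if y: "y \<in> Y" "norm y = 1" for y c
  proof -
    obtain a where a: "a \<in> A" "dist a y < \<epsilon> / 2" using A(3) y by fastforce
    have "norm (c *\<^sub>R ?\<phi> K + a) \<le> norm (c *\<^sub>R ?\<phi> K + y) + norm (a - y)"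
      using norm_triangle_ineq[of "c *\<^sub>R ?\<phi> K + y" "a - y"] by simp
    moreover have "norm a = 1" using A(2) a(1) by auto
    \<comment> \<open>One \<open>\<epsilon> / 2\<close> is the error at the net point
      \<open>a\<close>, the other the distance from \<open>a\<close> to \<open>y\<close>.\<close>
    ultimately have "\<bar>c\<bar> + 1 - \<epsilon> \<le> norm (c *\<^sub>R ?\<phi> K + y)"
      using K[OF a(1), of c] a(2) by (simp add: dist_norm)
    moreover have "0 \<le> \<epsilon> * \<bar>c\<bar>" using \<epsilon> by simp
    ultimately show ?thesis by (simp add: algebra_simps)
  qed
  have "(1 - \<epsilon>) * (\<bar>c\<bar> + norm y) \<le> norm (c *\<^sub>R ?\<phi> K + y)" if y: "y \<in> Y" for y c
  proof (cases "y = 0")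
    case True
    then show ?thesis using \<epsilon> by (simp add: norm_level_functional mult_le_cancel_right1 algebra_simps)
  next
    case False
    let ?r = "norm y"
    have r: "?r > 0" using False by simp
    \<comment> \<open>Both sides of the claim are homogeneous in the pair \<open>c\<close>,
      \<open>y\<close>, so normalising \<open>y\<close> reduces it to the unit sphere.\<close>
    have "(1 - \<epsilon>) * (\<bar>c / ?r\<bar> + 1) \<le> norm ((c / ?r) *\<^sub>R ?\<phi> K + y /\<^sub>R ?r)"
      using False y sub by (intro unit) (simp_all add: subspace_scale)
    then have "?r * ((1 - \<epsilon>) * (\<bar>c / ?r\<bar> + 1)) \<le> norm (?r *\<^sub>R ((c / ?r) *\<^sub>R ?\<phi> K + y /\<^sub>R ?r))"
      using r by simp
    moreover have "?r * ((1 - \<epsilon>) * (\<bar>c / ?r\<bar> + 1)) = (1 - \<epsilon>) * (\<bar>c\<bar> + ?r)"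
      using r by (simp add: field_simps)
    moreover have "?r *\<^sub>R ((c / ?r) *\<^sub>R ?\<phi> K + y /\<^sub>R ?r) = c *\<^sub>R ?\<phi> K + y"
      using r by (simp add: scaleR_add_right)
    ultimately show ?thesis by metis
  qed
  then show "\<exists>x\<in>sphere 0 1. \<forall>y\<in>Y. \<forall>c. (1 - \<epsilon>) * (\<bar>c\<bar> + norm y) \<le> norm (c *\<^sub>R x + y)"
    by (intro bexI[of _ "?\<phi> K"]) (auto simp: norm_level_functional)
qed

theorem theorem3p2:
  "strong_diameter_two TYPE(JH) \<and> octahedral_norm TYPE(JH \<Rightarrow>\<^sub>L real)"
  using strong_diameter_two_JH octahedral_norm_JH_dual by blast

end
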